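(* A stochastic process $X=(X_t)_{t\ge 0}$ on $(\Omega,\mathcal F,\mathsf P)$ is progressively measurable with respect to the filtration $(\mathcal F_t)_{t\ge 0}$ if and only if there exists a $\mathcal B([0,\infty))\otimes\mathcal H$-measurable function $C(t,\omega)$ such that $X_t(\omega)=C(t,\omega)$ on the set $\{t<\gamma\}$ (for all $t\ge 0$).
   Context: $(\Omega,\mathcal F,\mathsf P)$ is a probability space, $\mathcal H\subset\mathcal F$ is a sub-$\sigma$-algebra, and $\gamma$ is a random variable with values in $[0,\infty]$ such that $\mathsf P(\gamma>0)=1$. For $t\in[0,\infty)$, $\mathcal F_t$ is the collection of all $A\in\mathcal F$ for which there exists $C\in\mathcal H$ with $A\cap\{t<\gamma\}=C\cap\{t<\gamma\}$; $(\mathcal F_t)_{t\ge 0}$ is a right-continuous filtration. Standing assumption: this filtration contains all $\mathsf P$-null sets of $\mathcal F$ (so it satisfies the usual conditions).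
   Formalization: The process X is additionally assumed jointly B([0,∞))⊗F-measurable; if only each X_t is F-measurable, the "if" direction fails (Ω a point, γ=1, X_t=1_N(t) with N⊂[1,2] non-Borel, C=0). *)

theory Defs
  imports "HOL-Probability.Probability"
begin

text \<open>Time is \<open>[0, \<infinity>)\<close>, rendered as the nonnegative elements of \<open>real\<close>; the values of the objects
  below at negative times play no role.  Its Borel \<open>\<sigma>\<close>-algebra is
  \<open>restrict_space borel {0..}\<close>.  The random time takes values in \<open>[0, \<infinity>]\<close>, i.e. in \<open>ennreal\<close>.\<close>

definition alive :: "'a measure \<Rightarrow> ('a \<Rightarrow> ennreal) \<Rightarrow> real \<Rightarrow> 'a set"
  where "alive M \<gamma> t = {\<omega> \<in> space M. ennreal t < \<gamma> \<omega>}"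

text \<open>The \<open>\<sigma>\<close>-algebra at time \<open>t\<close>.  The generator is already a \<open>\<sigma>\<close>-algebra, see
  \<open>sets_jump_filtration\<close> below; as for \<open>pre_sigma\<close>, the measure carried by
  \<open>jump_filtration M H \<gamma> t\<close> is the zero measure and only its \<open>\<sigma>\<close>-algebra matters.\<close>

definition jump_filtration :: "'a measure \<Rightarrow> 'a measure \<Rightarrow> ('a \<Rightarrow> ennreal) \<Rightarrow> real \<Rightarrow> 'a measure"
  where "jump_filtration M H \<gamma> t =
    sigma (space M) {A \<in> sets M. \<exists>C\<in>sets H. A \<inter> alive M \<gamma> t = C \<inter> alive M \<gamma> t}"

text \<open>Stochastic processes are understood to be jointly measurable.  Measurability of each
  \<open>X t\<close> alone would not suffice for the intended characterisation of progressive measurability: with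
  \<open>\<gamma> = 1\<close>, trivial \<open>M\<close> and \<open>H\<close>, and a non-Borel set \<open>N \<subseteq> [1, \<infinity>)\<close>, the process
  \<open>X t \<omega> = indicator N t\<close> vanishes on \<open>t < \<gamma>\<close> but is not progressively measurable.\<close>

definition measurable_process :: "'a measure \<Rightarrow> (real \<Rightarrow> 'a \<Rightarrow> real) \<Rightarrow> bool"
  where "measurable_process M X \<longleftrightarrow>
    (\<lambda>(t, \<omega>). X t \<omega>) \<in> borel_measurable (restrict_space borel {0..} \<Otimes>\<^sub>M M)"

definition progressively_measurable :: "(real \<Rightarrow> 'a measure) \<Rightarrow> (real \<Rightarrow> 'a \<Rightarrow> real) \<Rightarrow> bool"
  where "progressively_measurable F X \<longleftrightarrow>
    (\<forall>t\<ge>0. (\<lambda>(s, \<omega>). X s \<omega>) \<in> borel_measurable (restrict_space borel {0..t} \<Otimes>\<^sub>M F t))"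

lemma space_jump_filtration [simp]: "space (jump_filtration M H \<gamma> t) = space M"
  unfolding jump_filtration_def
  by (rule space_measure_of) (auto dest: sets.sets_into_space)

lemma sets_jump_filtration:
  assumes "subalgebra M H"
  shows "sets (jump_filtration M H \<gamma> t) =
    {A \<in> sets M. \<exists>C\<in>sets H. A \<inter> alive M \<gamma> t = C \<inter> alive M \<gamma> t}" (is "_ = ?S")
proof -
  have sp: "space H = space M" using assms by (simp add: subalgebra_def)
  have "sigma_algebra (space M) ?S"
    unfolding sigma_algebra_iff2
  proof (intro conjI ballI allI impI)
    show "?S \<subseteq> Pow (space M)" by (auto dest: sets.sets_into_space)
    show "{} \<in> ?S" by blast
  next
    fix A assume "A \<in> ?S"
    then obtain C where A: "A \<in> sets M" "C \<in> sets H" "A \<inter> alive M \<gamma> t = C \<inter> alive M \<gamma> t" by auto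
    have "(space M - A) \<inter> alive M \<gamma> t = (space H - C) \<inter> alive M \<gamma> t"
      unfolding sp using A(3) by blast
    moreover have "space H - C \<in> sets H" using A(2) by (rule sets.compl_sets)
    ultimately show "space M - A \<in> ?S" using sets.compl_sets[OF A(1)] by blast
  next
    fix A :: "nat \<Rightarrow> 'a set" assume A: "range A \<subseteq> ?S"
    then have "\<forall>i. \<exists>C\<in>sets H. A i \<inter> alive M \<gamma> t = C \<inter> alive M \<gamma> t" by blast
    then obtain C where C: "\<And>i. C i \<in> sets H" "\<And>i. A i \<inter> alive M \<gamma> t = C i \<inter> alive M \<gamma> t"
      unfolding choice_iff Bex_def by blast
    have "(\<Union>i. A i) \<inter> alive M \<gamma> t = (\<Union>i. A i \<inter> alive M \<gamma> t)" by blast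
    also have "\<dots> = (\<Union>i. C i \<inter> alive M \<gamma> t)" unfolding C(2) ..
    also have "\<dots> = (\<Union>i. C i) \<inter> alive M \<gamma> t" by blast
    finally have "(\<Union>i. A i) \<inter> alive M \<gamma> t = (\<Union>i. C i) \<inter> alive M \<gamma> t" .
    moreover have "(\<Union>i. C i) \<in> sets H" using C(1) by (intro sets.countable_UN) auto
    moreover have "(\<Union>i. A i) \<in> sets M" using A by (intro sets.countable_UN) auto
    ultimately show "(\<Union>i. A i) \<in> ?S" by blast
  qed
  then show ?thesis
    unfolding jump_filtration_def by (rule sigma_algebra.sets_measure_of_eq)
qed

lemma alive_antimono: "s \<le> t \<Longrightarrow> alive M \<gamma> t \<subseteq> alive M \<gamma> s"
  unfolding alive_def by (auto intro: le_less_trans ennreal_leI)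

lemma filtration_jump_filtration:
  assumes "subalgebra M H"
  shows "filtration (space M) (jump_filtration M H \<gamma>)"
proof
  fix s t :: real assume "s \<le> t"
  show "sets (jump_filtration M H \<gamma> s) \<le> sets (jump_filtration M H \<gamma> t)"
    unfolding sets_jump_filtration[OF assms]
  proof (intro subsetI, elim CollectE conjE bexE, intro CollectI conjI)
    fix A C assume "C \<in> sets H" "A \<inter> alive M \<gamma> s = C \<inter> alive M \<gamma> s"
    moreover have "alive M \<gamma> t \<subseteq> alive M \<gamma> s" using \<open>s \<le> t\<close> by (rule alive_antimono)
    ultimately have "A \<inter> alive M \<gamma> t = C \<inter> alive M \<gamma> t" by blast
    then show "\<exists>C\<in>sets H. A \<inter> alive M \<gamma> t = C \<inter> alive M \<gamma> t" using \<open>C \<in> sets H\<close> by (rule bexI)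
  qed
qed simp

lemma jump_filtration_right_continuous:
  assumes H: "subalgebra M H" and t: "0 \<le> t"
  shows "(\<Inter>s\<in>{t<..}. sets (jump_filtration M H \<gamma> s)) = sets (jump_filtration M H \<gamma> t)"
proof
  interpret filtration "space M" "jump_filtration M H \<gamma>"
    by (rule filtration_jump_filtration[OF H])
  show "sets (jump_filtration M H \<gamma> t) \<subseteq> (\<Inter>s\<in>{t<..}. sets (jump_filtration M H \<gamma> s))"
    by (intro INT_greatest sets_F_mono) simp
  show "(\<Inter>s\<in>{t<..}. sets (jump_filtration M H \<gamma> s)) \<subseteq> sets (jump_filtration M H \<gamma> t)"
  proof
    fix A assume A: "A \<in> (\<Inter>s\<in>{t<..}. sets (jump_filtration M H \<gamma> s))"
    define u where "u n = t + 1 / real (Suc n)" for n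
    have u: "u n > t" for n by (simp add: u_def)
    have Au: "A \<in> sets (jump_filtration M H \<gamma> (u n))" for n using A u by blast
    have "\<forall>n. \<exists>C\<in>sets H. A \<inter> alive M \<gamma> (u n) = C \<inter> alive M \<gamma> (u n)"
      using Au by (simp add: sets_jump_filtration[OF H])
    then obtain C where C: "\<And>n. C n \<in> sets H"
        "\<And>n. A \<inter> alive M \<gamma> (u n) = C n \<inter> alive M \<gamma> (u n)"
      unfolding choice_iff Bex_def by blast
    define D where "D = (\<Union>m. \<Inter>n\<in>{m..}. C n)"
    have D: "D \<in> sets H" unfolding D_def using C(1) by (intro sets.countable_UN sets.countable_INT) auto
    have "(\<omega> \<in> A) = (\<omega> \<in> D)" if \<omega>: "\<omega> \<in> alive M \<gamma> t" for \<omega>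
    proof -
      have lt: "ennreal t < \<gamma> \<omega>" using \<omega> by (simp add: alive_def)
      have "(\<lambda>n. ennreal (u n)) \<longlonglongrightarrow> ennreal t"
        unfolding u_def
        using tendsto_add[OF tendsto_const LIMSEQ_Suc[OF lim_1_over_n], of t]
        by (intro tendsto_ennrealI) simp
      then have "eventually (\<lambda>n. ennreal (u n) < \<gamma> \<omega>) sequentially"
        using lt by (rule order_tendstoD)
      then obtain m where m: "\<And>n. n \<ge> m \<Longrightarrow> \<omega> \<in> alive M \<gamma> (u n)"
        using \<omega> unfolding eventually_sequentially alive_def by auto
      then have eq: "\<omega> \<in> A \<longleftrightarrow> \<omega> \<in> C n" if "n \<ge> m" for n using C(2)[of n] that by blast
      show ?thesis
      proof
        assume "\<omega> \<in> A" then show "\<omega> \<in> D" unfolding D_def using eq by auto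
      next
        assume "\<omega> \<in> D"
        then obtain k where "\<And>n. n \<ge> k \<Longrightarrow> \<omega> \<in> C n" unfolding D_def by auto
        then show "\<omega> \<in> A" using eq[of "max k m"] by auto
      qed
    qed
    then have "A \<inter> alive M \<gamma> t = D \<inter> alive M \<gamma> t" by blast
    moreover have "A \<in> sets M" using Au by (simp add: sets_jump_filtration[OF H])
    ultimately show "A \<in> sets (jump_filtration M H \<gamma> t)"
      unfolding sets_jump_filtration[OF H] using D by blast
  qed
qed

end

theory Submission
  imports Defs
begin

text \<open>
  Up to time \<open>t\<close>, the \<open>\<sigma>\<close>-algebra at time \<open>t\<close> looks like \<open>H\<close> on the event \<open>{t < \<gamma>}\<close> and like \<open>M\<close>
  on its complement.  Both halves of the proof exploit this through one principle: if every set of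
  \<open>N\<close> coincides on \<open>A\<close> with a set of \<open>N'\<close>, then the same holds for the product \<open>\<sigma>\<close>-algebras
  on a cylinder over \<open>A\<close> (\<open>pair_sets_agree_on_cylinder\<close>), and hence every real function measurable for
  \<open>N\<close> coincides on \<open>A\<close> with one that is measurable for \<open>N'\<close>
  (\<open>borel_measurable_agree_on\<close>).  What makes this useful is that \<open>A\<close> may be
  \<open>{t < \<gamma>}\<close>, which in general does not belong to \<open>H\<close>.

  If \<open>X\<close> is progressively measurable, the principle yields for each \<open>t\<close> a function \<open>C\<^sub>t\<close>, jointly
  measurable with respect to \<open>H\<close>, with \<open>X s \<omega> = C\<^sub>t s \<omega>\<close> for \<open>s \<le> t < \<gamma> \<omega>\<close>.  A value of
  \<open>t\<close> lying between \<open>s\<close> and \<open>\<gamma> \<omega>\<close> cannot in general be chosen in an \<open>H\<close>-measurable way, since \<open>\<gamma>\<close> need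
  not be \<open>H\<close>-measurable.  Instead one takes grid times \<open>t\<^sub>n(s) > s\<close> that converge to \<open>s\<close> and do not depend
  on \<open>\<omega>\<close>: as soon as \<open>s < \<gamma> \<omega>\<close>, eventually \<open>t\<^sub>n(s) < \<gamma> \<omega>\<close>, so
  the sequence \<open>C\<^bsub>t\<^sub>n(s)\<^esub> s \<omega>\<close> is eventually equal to \<open>X s \<omega>\<close>, and its limit is the required
  function.  It is jointly measurable because \<open>t\<^sub>n\<close> takes only countably many values.

  Conversely, fix \<open>t\<close> and split \<open>\<Omega>\<close> into \<open>{t < \<gamma>}\<close> and its complement, both of which belong to
  the \<open>\<sigma>\<close>-algebra at time \<open>t\<close>.  On the first, \<open>X = C\<close> up to time \<open>t\<close>; on the second, joint
  measurability of \<open>X\<close> with respect to \<open>M\<close> is as good as joint measurability with respect to the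
  \<open>\<sigma>\<close>-algebra at time \<open>t\<close>.
\<close>

section \<open>Sets and functions that agree on a possibly non-measurable set\<close>

text \<open>The sets of the product that have a partner form a \<open>\<sigma>\<close>-algebra, because complements and
  countable unions can be taken separately in the two product spaces; and it contains the
  rectangles.\<close>

lemma pair_sets_agree_on_cylinder:
  assumes sp: "space N = space N'"
    and agree: "\<And>E. E \<in> sets N \<Longrightarrow> \<exists>E'\<in>sets N'. E \<inter> A = E' \<inter> A"
    and E: "E \<in> sets (T \<Otimes>\<^sub>M N)"
  shows "\<exists>E'\<in>sets (T \<Otimes>\<^sub>M N'). E \<inter> (UNIV \<times> A) = E' \<inter> (UNIV \<times> A)"
  using E unfolding sets_pair_measure
proof (induction rule: sigma_sets.induct)
  case (Basic E)
  then obtain a b where E: "E = a \<times> b" "a \<in> sets T" "b \<in> sets N" by blast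
  obtain b' where b': "b' \<in> sets N'" "b \<inter> A = b' \<inter> A" using agree[OF E(3)] by blast
  have "E \<inter> (UNIV \<times> A) = (a \<times> b') \<inter> (UNIV \<times> A)" using b'(2) unfolding E by blast
  moreover have "a \<times> b' \<in> sets (T \<Otimes>\<^sub>M N')" using E b' by simp
  ultimately show ?case unfolding sets_pair_measure by blast
next
  case Empty
  show ?case by (rule bexI[of _ "{}"]) (auto intro: sigma_sets.Empty)
next
  case (Compl E)
  then obtain E' where E': "E' \<in> sets (T \<Otimes>\<^sub>M N')" "E \<inter> (UNIV \<times> A) = E' \<inter> (UNIV \<times> A)"
    unfolding sets_pair_measure by blast
  have "(space T \<times> space N - E) \<inter> (UNIV \<times> A) = (space (T \<Otimes>\<^sub>M N') - E') \<inter> (UNIV \<times> A)"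
    using E'(2) unfolding space_pair_measure sp by blast
  moreover have "space (T \<Otimes>\<^sub>M N') - E' \<in> sets (T \<Otimes>\<^sub>M N')" using E'(1) by (rule sets.compl_sets)
  ultimately show ?case unfolding sets_pair_measure by blast
next
  case (Union E)
  then have "\<forall>i. \<exists>E'\<in>sets (T \<Otimes>\<^sub>M N'). E i \<inter> (UNIV \<times> A) = E' \<inter> (UNIV \<times> A)"
    unfolding sets_pair_measure by blast
  then obtain E' where E': "\<And>i. E' i \<in> sets (T \<Otimes>\<^sub>M N')"
      "\<And>i. E i \<inter> (UNIV \<times> A) = E' i \<inter> (UNIV \<times> A)"
    unfolding choice_iff Bex_def by blast
  have "(\<Union>i. E i) \<inter> (UNIV \<times> A) = (\<Union>i. E i \<inter> (UNIV \<times> A))" by blast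
  also have "\<dots> = (\<Union>i. E' i) \<inter> (UNIV \<times> A)" unfolding E'(2) by blast
  finally have "(\<Union>i. E i) \<inter> (UNIV \<times> A) = (\<Union>i. E' i) \<inter> (UNIV \<times> A)" .
  moreover have "(\<Union>i. E' i) \<in> sets (T \<Otimes>\<^sub>M N')" using E'(1) by (intro sets.countable_UN) auto
  ultimately show ?case unfolding sets_pair_measure by blast
qed

text \<open>A real function is recovered from its superlevel sets \<open>{f > q}\<close> at rational levels as
  \<open>f x = sup {q. f x > q}\<close>.  Replacing each superlevel set by its partner
  gives the function sought; off \<open>A\<close> the partners need not be nested and the
  supremum may be infinite, so it is formed in the extended reals.\<close>

lemma borel_measurable_agree_on:
  fixes f :: "'a \<Rightarrow> real"
  assumes f: "f \<in> borel_measurable N" and A: "A \<subseteq> space N"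
    and agree: "\<And>E. E \<in> sets N \<Longrightarrow> \<exists>E'\<in>sets N'. E \<inter> A = E' \<inter> A"
  obtains g :: "'a \<Rightarrow> real" where "g \<in> borel_measurable N'" "\<And>x. x \<in> A \<Longrightarrow> g x = f x"
proof -
  have "{x \<in> space N. of_rat q < f x} \<in> sets N" for q using f by measurable
  then have "\<forall>q. \<exists>E'\<in>sets N'. {x \<in> space N. of_rat q < f x} \<inter> A = E' \<inter> A"
    using agree by blast
  then obtain E where E [measurable]: "\<And>q. E q \<in> sets N'"
      and E_A: "\<And>q. {x \<in> space N. of_rat q < f x} \<inter> A = E q \<inter> A"
    unfolding choice_iff Bex_def by blast
  define h :: "'a \<Rightarrow> ereal"
    where "h x = (SUP q. if x \<in> E q then ereal (of_rat q) else -\<infinity>)" for x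
  have h [measurable]: "h \<in> borel_measurable N'" unfolding h_def by measurable
  have "h x = ereal (f x)" if x: "x \<in> A" for x
  proof (rule antisym)
    have in_E: "x \<in> E q \<longleftrightarrow> of_rat q < f x" for q using E_A[of q] x A by blast
    show "h x \<le> ereal (f x)" unfolding h_def in_E by (rule SUP_least) auto
    show "ereal (f x) \<le> h x"
    proof (rule dense_le)
      fix z assume z: "z < ereal (f x)"
      have "\<exists>r. z < ereal r \<and> r < f x" using ereal_dense2[OF z] by auto
      then obtain r where r: "z < ereal r" "r < f x" by blast
      obtain q where q: "r < of_rat q" "of_rat q < f x" using of_rat_dense[OF r(2)] by blast
      have "z \<le> ereal (of_rat q)" using r q by (metis less_eq_ereal_def less_ereal.simps(1) less_trans)
      also have "\<dots> \<le> h x"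
        unfolding h_def in_E using q(2) by (intro SUP_upper2[of q]) auto
      finally show "z \<le> h x" .
    qed
  qed
  then show ?thesis by (intro that[of "\<lambda>x. real_of_ereal (h x)"]) auto
qed

lemma borel_measurable_pair_agree_on_cylinder:
  fixes f :: "'b \<times> 'a \<Rightarrow> real"
  assumes "f \<in> borel_measurable (T \<Otimes>\<^sub>M N)" "space N = space N'" "A \<subseteq> space N"
    and "\<And>E. E \<in> sets N \<Longrightarrow> \<exists>E'\<in>sets N'. E \<inter> A = E' \<inter> A"
  obtains g :: "'b \<times> 'a \<Rightarrow> real" where "g \<in> borel_measurable (T \<Otimes>\<^sub>M N')"
    "\<And>s x. s \<in> space T \<Longrightarrow> x \<in> A \<Longrightarrow> g (s, x) = f (s, x)"
proof -
  have "\<exists>E'\<in>sets (T \<Otimes>\<^sub>M N'). E \<inter> (space T \<times> A) = E' \<inter> (space T \<times> A)"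
    if "E \<in> sets (T \<Otimes>\<^sub>M N)" for E
    using pair_sets_agree_on_cylinder[OF assms(2,4) that] by blast
  moreover have "space T \<times> A \<subseteq> space (T \<Otimes>\<^sub>M N)"
    using assms(3) by (auto simp: space_pair_measure)
  ultimately obtain g where "g \<in> borel_measurable (T \<Otimes>\<^sub>M N')"
      "\<And>y. y \<in> space T \<times> A \<Longrightarrow> g y = f y"
    using borel_measurable_agree_on[OF assms(1)] by metis
  then show ?thesis by (intro that[of g]) auto
qed

section \<open>The filtration before and after the jump\<close>

lemma sets_subalgebra_subset_jump_filtration:
  assumes "subalgebra M H" shows "sets H \<subseteq> sets (jump_filtration M H \<gamma> t)"
  using assms unfolding sets_jump_filtration[OF assms] subalgebra_def by blast

text \<open>Once the jump has occurred, everything is known: the defining condition only concerns the part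
  of a set inside \<open>{t < \<gamma>}\<close>, which is empty here, so \<open>{}\<close> serves as the witness in \<open>H\<close>.\<close>

lemma sets_jump_filtration_after_jump:
  assumes "subalgebra M H" "E \<in> sets M" "E \<inter> alive M \<gamma> t = {}"
  shows "E \<in> sets (jump_filtration M H \<gamma> t)"
  unfolding sets_jump_filtration[OF assms(1)] using assms(2,3) by blast

lemma alive_in_sets [measurable]:
  assumes [measurable]: "\<gamma> \<in> borel_measurable M"
  shows "alive M \<gamma> t \<in> sets M"
  unfolding alive_def by measurable

lemma alive_in_jump_filtration:
  assumes "subalgebra M H" "\<gamma> \<in> borel_measurable M"
  shows "alive M \<gamma> t \<in> sets (jump_filtration M H \<gamma> t)"
proof -
  have "space M - (space M - alive M \<gamma> t) \<in> sets (jump_filtration M H \<gamma> t)"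
    using assms
    by (subst (1) space_jump_filtration[symmetric, of M H \<gamma> t], intro sets.compl_sets
        sets_jump_filtration_after_jump) auto
  moreover have "space M - (space M - alive M \<gamma> t) = alive M \<gamma> t" by (auto simp: alive_def)
  ultimately show ?thesis by simp
qed

section \<open>Progressive measurability\<close>

text \<open>Every set of the \<open>\<sigma>\<close>-algebra at time \<open>t\<close> coincides with a set of \<open>H\<close> on \<open>{t < \<gamma>}\<close>, so the
  agreement principle applies on the cylinder over this event.\<close>

lemma progressively_measurable_representation_up_to:
  assumes H: "subalgebra M H" and X: "progressively_measurable (jump_filtration M H \<gamma>) X"
    and t: "0 \<le> t"
  obtains g where "g \<in> borel_measurable (restrict_space borel {0..} \<Otimes>\<^sub>M H)"
    "\<And>s \<omega>. 0 \<le> s \<Longrightarrow> s \<le> t \<Longrightarrow> \<omega> \<in> alive M \<gamma> t \<Longrightarrow> g (s, \<omega>) = X s \<omega>"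
proof -
  have "(\<lambda>(s, \<omega>). X s \<omega>) \<in>
      borel_measurable (restrict_space borel {0..t} \<Otimes>\<^sub>M jump_filtration M H \<gamma> t)"
    using X t by (simp add: progressively_measurable_def)
  moreover have "space (jump_filtration M H \<gamma> t) = space H"
    using H by (simp add: subalgebra_def)
  moreover have "alive M \<gamma> t \<subseteq> space (jump_filtration M H \<gamma> t)" by (auto simp: alive_def)
  ultimately obtain g where g [measurable]:
      "g \<in> borel_measurable (restrict_space borel {0..t} \<Otimes>\<^sub>M H)"
      and g_X: "\<And>s \<omega>. s \<in> space (restrict_space borel {0..t}) \<Longrightarrow> \<omega> \<in> alive M \<gamma> t \<Longrightarrow>
        g (s, \<omega>) = (\<lambda>(s, \<omega>). X s \<omega>) (s, \<omega>)"
    by (rule borel_measurable_pair_agree_on_cylinder) (auto simp: sets_jump_filtration[OF H])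
  \<comment> \<open>Freezing the time argument at \<open>t\<close> extends \<open>g\<close> measurably from \<open>[0, t]\<close> to \<open>[0, \<infinity>)\<close>.\<close>
  have min [measurable]:
    "(\<lambda>s. min s t) \<in> restrict_space borel {0..} \<rightarrow>\<^sub>M restrict_space borel {0..t}"
    using t by (intro measurable_restrict_space2 measurable_restrict_space1)
      (auto simp: space_restrict_space)
  show ?thesis
  proof (rule that)
    show "(\<lambda>(s, \<omega>). g (min s t, \<omega>)) \<in> borel_measurable (restrict_space borel {0..} \<Otimes>\<^sub>M H)"
      by measurable
  qed (use g_X in \<open>auto simp: space_restrict_space\<close>)
qed

lemma progressively_measurable_imp_representation:
  assumes H: "subalgebra M H" and X: "progressively_measurable (jump_filtration M H \<gamma>) X"
  shows "\<exists>C :: real \<Rightarrow> 'a \<Rightarrow> real.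
    (\<lambda>(t, \<omega>). C t \<omega>) \<in> borel_measurable (restrict_space borel {0..} \<Otimes>\<^sub>M H) \<and>
    (\<forall>t\<ge>0. \<forall>\<omega>\<in>alive M \<gamma> t. X t \<omega> = C t \<omega>)"
proof -
  let ?P = "restrict_space borel {0..} \<Otimes>\<^sub>M H :: (real \<times> 'a) measure"
  have "\<exists>g. 0 \<le> t \<longrightarrow> g \<in> borel_measurable ?P \<and>
      (\<forall>s \<omega>. 0 \<le> s \<longrightarrow> s \<le> t \<longrightarrow> \<omega> \<in> alive M \<gamma> t \<longrightarrow> g (s, \<omega>) = X s \<omega>)" for t
  proof (cases "0 \<le> t")
    case True
    obtain g where "g \<in> borel_measurable ?P"
        "\<And>s \<omega>. 0 \<le> s \<Longrightarrow> s \<le> t \<Longrightarrow> \<omega> \<in> alive M \<gamma> t \<Longrightarrow> g (s, \<omega>) = X s \<omega>"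
      by (rule progressively_measurable_representation_up_to[OF H X True]) (rule that)
    then show ?thesis by (intro exI[of _ g]) simp
  qed simp
  then have "\<exists>G. \<forall>t. 0 \<le> t \<longrightarrow> G t \<in> borel_measurable ?P \<and>
      (\<forall>s \<omega>. 0 \<le> s \<longrightarrow> s \<le> t \<longrightarrow> \<omega> \<in> alive M \<gamma> t \<longrightarrow> G t (s, \<omega>) = X s \<omega>)"
    by (intro choice allI)
  then obtain G where GX: "\<forall>t. 0 \<le> t \<longrightarrow> G t \<in> borel_measurable ?P \<and>
      (\<forall>s \<omega>. 0 \<le> s \<longrightarrow> s \<le> t \<longrightarrow> \<omega> \<in> alive M \<gamma> t \<longrightarrow> G t (s, \<omega>) = X s \<omega>)" ..
  have G: "G t \<in> borel_measurable ?P" if "0 \<le> t" for t using GX that by simp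
  have G_X: "G t (s, \<omega>) = X s \<omega>" if "0 \<le> s" "s \<le> t" "\<omega> \<in> alive M \<gamma> t" for s t \<omega>
    using GX order_trans[OF that(1,2)] that by simp
  \<comment> \<open>\<open>grid n (ix n s)\<close> is the first multiple of \<open>1 / (n + 1)\<close> strictly after \<open>s\<close>; the index is kept
    apart from the time so that measurability can be checked one index at a time.\<close>
  define grid where "grid n k = real k / real (Suc n)" for n k
  define ix where "ix n s = Suc (nat \<lfloor>s * real (Suc n)\<rfloor>)" for n s
  have ix_gt: "s < grid n (ix n s)" and ix_le: "grid n (ix n s) \<le> s + 1 / real (Suc n)"
    if "0 \<le> s" for n s
  proof -
    have fl: "real (nat \<lfloor>s * real (Suc n)\<rfloor>) = real_of_int \<lfloor>s * real (Suc n)\<rfloor>"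
      using that by simp
    have "s * real (Suc n) < real (ix n s)" "real (ix n s) \<le> s * real (Suc n) + 1"
      using floor_correct[of "s * real (Suc n)"] unfolding ix_def of_nat_Suc[of "nat _"] fl
      by linarith+
    then show "s < grid n (ix n s)" "grid n (ix n s) \<le> s + 1 / real (Suc n)"
      unfolding grid_def
      by (simp_all add: pos_less_divide_eq pos_divide_le_eq distrib_right del: of_nat_Suc)
  qed
  define C where "C s \<omega> = lim (\<lambda>n. G (grid n (ix n s)) (s, \<omega>))" for s \<omega>
  have "(\<lambda>p. G (grid n (ix n (fst p))) p) \<in> borel_measurable ?P" for n
  proof (rule measurable_compose_countable)
    show "G (grid n k) \<in> borel_measurable ?P" for k by (rule G) (simp add: grid_def)
    have [measurable]: "fst \<in> ?P \<rightarrow>\<^sub>M borel"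
      by (rule measurable_compose[OF measurable_fst measurable_restrict_space1]) simp
    show "(\<lambda>p. ix n (fst p)) \<in> ?P \<rightarrow>\<^sub>M count_space UNIV" unfolding ix_def by measurable
  qed
  then have "(\<lambda>p. lim (\<lambda>n. G (grid n (ix n (fst p))) p)) \<in> borel_measurable ?P"
    by (rule borel_measurable_lim_metric)
  then have "(\<lambda>(s, \<omega>). C s \<omega>) \<in> borel_measurable ?P"
    by (simp add: C_def case_prod_beta')
  moreover have "X s \<omega> = C s \<omega>" if s: "0 \<le> s" and \<omega>: "\<omega> \<in> alive M \<gamma> s" for s \<omega>
  proof -
    have "(\<lambda>n. s + 1 / real (Suc n)) \<longlonglongrightarrow> s"
      using tendsto_add[OF tendsto_const LIMSEQ_Suc[OF lim_1_over_n], of s] by simp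
    then have "(\<lambda>n. ennreal (s + 1 / real (Suc n))) \<longlonglongrightarrow> ennreal s" by (rule tendsto_ennrealI)
    moreover have "ennreal s < \<gamma> \<omega>" using \<omega> by (simp add: alive_def)
    ultimately have "\<forall>\<^sub>F n in sequentially. ennreal (s + 1 / real (Suc n)) < \<gamma> \<omega>"
      by (rule order_tendstoD)
    then have "\<forall>\<^sub>F n in sequentially. G (grid n (ix n s)) (s, \<omega>) = X s \<omega>"
    proof eventually_elim
      case (elim n)
      then have "\<omega> \<in> alive M \<gamma> (s + 1 / real (Suc n))" using \<omega> by (simp add: alive_def)
      then have "\<omega> \<in> alive M \<gamma> (grid n (ix n s))"
        by (rule subsetD[OF alive_antimono[OF ix_le[OF s]]])
      from G_X[OF s less_imp_le[OF ix_gt[OF s]] this] show ?case .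
    qed
    from limI[OF tendsto_eventually[OF this]] show ?thesis unfolding C_def by (rule sym)
  qed
  ultimately show ?thesis by (intro exI[of _ C] conjI allI impI ballI)
qed

text \<open>The two pieces of \<open>X\<close>, before and after the jump, are glued along \<open>{t < \<gamma>}\<close> at the final
  time \<open>t\<close> and not along \<open>{s < \<gamma>}\<close>: that keeps the pieces on cylinders, and the identity with \<open>C\<close>
  at time \<open>s \<le> t\<close> is available because \<open>{t < \<gamma>} \<subseteq> {s < \<gamma>}\<close>.\<close>

lemma representation_imp_progressively_measurable:
  assumes H: "subalgebra M H" and \<gamma>: "\<gamma> \<in> borel_measurable M"
    and X: "measurable_process M X"
    and C: "(\<lambda>(t, \<omega>). C t \<omega>) \<in> borel_measurable (restrict_space borel {0..} \<Otimes>\<^sub>M H)"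
    and X_C: "\<And>t \<omega>. 0 \<le> t \<Longrightarrow> \<omega> \<in> alive M \<gamma> t \<Longrightarrow> X t \<omega> = C t \<omega>"
  shows "progressively_measurable (jump_filtration M H \<gamma>) X"
  unfolding progressively_measurable_def
proof (intro allI impI)
  fix t :: real assume t: "0 \<le> t"
  let ?T = "restrict_space borel {0..t} :: real measure"
  let ?F = "jump_filtration M H \<gamma> t"
  have T [measurable]: "(\<lambda>s. s) \<in> ?T \<rightarrow>\<^sub>M restrict_space borel {0..}"
    by (intro measurable_restrict_space2 measurable_restrict_space1)
      (auto simp: space_restrict_space)
  have [measurable]: "(\<lambda>(s, \<omega>). X s \<omega>) \<in> borel_measurable (restrict_space borel {0..} \<Otimes>\<^sub>M M)"
    using X by (simp add: measurable_process_def)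
  have "(\<lambda>(s, \<omega>). X s \<omega>) \<in> borel_measurable (?T \<Otimes>\<^sub>M M)"
  proof -
    have "(\<lambda>p. (fst p, snd p)) \<in> ?T \<Otimes>\<^sub>M M \<rightarrow>\<^sub>M restrict_space borel {0..} \<Otimes>\<^sub>M M"
      by (intro measurable_Pair measurable_compose[OF measurable_fst T]) simp
    from measurable_compose[OF this \<open>_ \<in> borel_measurable (restrict_space borel {0..} \<Otimes>\<^sub>M M)\<close>]
    show ?thesis by (simp add: case_prod_beta')
  qed
  moreover have "space M = space ?F" by simp
  moreover have "\<exists>E'\<in>sets ?F. E \<inter> (space M - alive M \<gamma> t) = E' \<inter> (space M - alive M \<gamma> t)"
    if "E \<in> sets M" for E
  proof (rule bexI)
    show "E \<inter> (space M - alive M \<gamma> t) \<in> sets ?F"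
      using that \<gamma> by (intro sets_jump_filtration_after_jump[OF H]) auto
  qed blast
  ultimately obtain g where g: "g \<in> borel_measurable (?T \<Otimes>\<^sub>M ?F)"
      and g_X: "\<And>s \<omega>. s \<in> space ?T \<Longrightarrow> \<omega> \<in> space M - alive M \<gamma> t \<Longrightarrow>
        g (s, \<omega>) = (\<lambda>(s, \<omega>). X s \<omega>) (s, \<omega>)"
    using borel_measurable_pair_agree_on_cylinder[of "\<lambda>(s, \<omega>). X s \<omega>" ?T M ?F
        "space M - alive M \<gamma> t", OF _ _ Diff_subset] by blast
  have "(\<lambda>\<omega>. \<omega>) \<in> ?F \<rightarrow>\<^sub>M H"
  proof (rule measurableI)
    fix E assume "E \<in> sets H"
    moreover from this have "(\<lambda>\<omega>. \<omega>) -` E \<inter> space ?F = E"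
      using H by (auto simp: subalgebra_def dest: sets.sets_into_space)
    ultimately show "(\<lambda>\<omega>. \<omega>) -` E \<inter> space ?F \<in> sets ?F"
      using sets_subalgebra_subset_jump_filtration[OF H] by auto
  qed (use H in \<open>simp add: subalgebra_def\<close>)
  then have "(\<lambda>p. (fst p, snd p)) \<in> ?T \<Otimes>\<^sub>M ?F \<rightarrow>\<^sub>M restrict_space borel {0..} \<Otimes>\<^sub>M H"
    by (intro measurable_Pair measurable_compose[OF measurable_fst T]
        measurable_compose[OF measurable_snd])
  from measurable_compose[OF this C]
  have C_F: "(\<lambda>p. C (fst p) (snd p)) \<in> borel_measurable (?T \<Otimes>\<^sub>M ?F)" by simp
  have [measurable]: "alive M \<gamma> t \<in> sets ?F" by (rule alive_in_jump_filtration[OF H \<gamma>])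
  have "(\<lambda>p. if snd p \<in> alive M \<gamma> t then C (fst p) (snd p) else g p)
      \<in> borel_measurable (?T \<Otimes>\<^sub>M ?F)"
    using C_F g by measurable
  moreover have "(if snd p \<in> alive M \<gamma> t then C (fst p) (snd p) else g p) = (\<lambda>(s, \<omega>). X s \<omega>) p"
    if p: "p \<in> space (?T \<Otimes>\<^sub>M ?F)" for p
  proof -
    obtain s \<omega> where p_eq: "p = (s, \<omega>)" by (cases p)
    have s: "0 \<le> s" "s \<le> t" "s \<in> space ?T" and \<omega>: "\<omega> \<in> space M"
      using p unfolding p_eq by (auto simp: space_pair_measure space_restrict_space)
    show ?thesis
      using X_C[OF s(1), of \<omega>] alive_antimono[OF s(2), of M \<gamma>] g_X[OF s(3), of \<omega>] \<omega>
      unfolding p_eq by auto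
  qed
  ultimately show "(\<lambda>(s, \<omega>). X s \<omega>) \<in> borel_measurable (?T \<Otimes>\<^sub>M ?F)"
    by (simp cong: measurable_cong)
qed

theorem proposition2p4:
  fixes M H :: "'a measure"
    and \<gamma> :: "'a \<Rightarrow> ennreal"
    and X :: "real \<Rightarrow> 'a \<Rightarrow> real"
  assumes "prob_space M"
    and "subalgebra M H"
    and "\<gamma> \<in> borel_measurable M"
    and "measure M {\<omega> \<in> space M. 0 < \<gamma> \<omega>} = 1"
    and "\<forall>t\<ge>0. null_sets M \<subseteq> sets (jump_filtration M H \<gamma> t)"
    and "measurable_process M X"
  shows "progressively_measurable (jump_filtration M H \<gamma>) X \<longleftrightarrow>
    (\<exists>C :: real \<Rightarrow> 'a \<Rightarrow> real.
       (\<lambda>(t, \<omega>). C t \<omega>) \<in> borel_measurable (restrict_space borel {0..} \<Otimes>\<^sub>M H) \<and>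
       (\<forall>t\<ge>0. \<forall>\<omega>\<in>alive M \<gamma> t. X t \<omega> = C t \<omega>))"
proof
  assume "progressively_measurable (jump_filtration M H \<gamma>) X"
  with assms(2) show "\<exists>C :: real \<Rightarrow> 'a \<Rightarrow> real.
      (\<lambda>(t, \<omega>). C t \<omega>) \<in> borel_measurable (restrict_space borel {0..} \<Otimes>\<^sub>M H) \<and>
      (\<forall>t\<ge>0. \<forall>\<omega>\<in>alive M \<gamma> t. X t \<omega> = C t \<omega>)"
    by (rule progressively_measurable_imp_representation)
next
  assume "\<exists>C :: real \<Rightarrow> 'a \<Rightarrow> real.
      (\<lambda>(t, \<omega>). C t \<omega>) \<in> borel_measurable (restrict_space borel {0..} \<Otimes>\<^sub>M H) \<and>
      (\<forall>t\<ge>0. \<forall>\<omega>\<in>alive M \<gamma> t. X t \<omega> = C t \<omega>)"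
  then obtain C :: "real \<Rightarrow> 'a \<Rightarrow> real" where
      C: "(\<lambda>(t, \<omega>). C t \<omega>) \<in> borel_measurable (restrict_space borel {0..} \<Otimes>\<^sub>M H)"
      and X_C: "\<forall>t\<ge>0. \<forall>\<omega>\<in>alive M \<gamma> t. X t \<omega> = C t \<omega>"
    by (elim exE conjE)
  from assms(2,3,6) C show "progressively_measurable (jump_filtration M H \<gamma>) X"
    by (rule representation_imp_progressively_measurable) (use X_C in simp)
qed

end
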